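(* Let $X$ be a compact metric space and let $f\colon X\to X$ be a continuous map. If $X=USC(\omega_f)$, i.e. the set-valued map $\omega_f$ is upper semicontinuous at every point of $X$, then $X=LSC(\omega_f)$, i.e. $\omega_f$ is lower semicontinuous at every point of $X$.
   Context: $(X,d)$ is a compact metric space, $f\colon X\to X$ is continuous, and $\mathcal{K}(X)$ is the set of non-empty closed subsets of $X$. $\omega_f(x)$ is the set of $y\in X$ such that $\lim_{j\to\infty}f^{i_j}(x)=y$ for some $0\le i_1<i_2<\cdots$; $\omega_f$ is regarded as a map $X\to\mathcal{K}(X)$. A map $\phi\colon X\to\mathcal{K}(X)$ is upper semicontinuous at $x$ if for every open $U\subset X$ with $\phi(x)\subset U$ there is $\delta>0$ such that $d(x,y)\le\delta$ implies $\phi(y)\subset U$ for all $y\in X$; it is lower semicontinuous at $x$ if for every open $U\subset X$ with $\phi(x)\cap U\ne\emptyset$ there is $\delta>0$ such that $d(x,y)\le\delta$ implies $\phi(y)\cap U\ne\emptyset$ for all $y\in X$. $USC(\phi)$ and $LSC(\phi)$ are the sets of upper, resp. lower, semicontinuity points of $\phi$. *)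

theory Defs
  imports "HOL-Analysis.Analysis"
begin

text \<open>
  The compact metric space is a compact subset \<open>X\<close> of a type of class \<^class>\<open>metric_space\<close>,
  carrying the restricted metric. All notions are relative to \<open>X\<close>: open and closed subsets
  are those of the subspace topology, and points range over \<open>X\<close> only.
\<close>

definition closed_hyperspace :: "'a::topological_space set \<Rightarrow> 'a set set" where
  "closed_hyperspace X = {A. A \<noteq> {} \<and> closedin (top_of_set X) A}"

definition omega_limit :: "'a::topological_space set \<Rightarrow> ('a \<Rightarrow> 'a) \<Rightarrow> 'a \<Rightarrow> 'a set" where
  "omega_limit X f x =
    {y \<in> X. \<exists>i :: nat \<Rightarrow> nat. strict_mono i \<and> (\<lambda>j. (f ^^ i j) x) \<longlonglongrightarrow> y}"

definition usc_at :: "'a::metric_space set \<Rightarrow> ('a \<Rightarrow> 'a set) \<Rightarrow> 'a \<Rightarrow> bool" where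
  "usc_at X \<phi> x \<longleftrightarrow>
    (\<forall>U. openin (top_of_set X) U \<and> \<phi> x \<subseteq> U \<longrightarrow>
      (\<exists>\<delta>>0. \<forall>y\<in>X. dist x y \<le> \<delta> \<longrightarrow> \<phi> y \<subseteq> U))"

definition lsc_at :: "'a::metric_space set \<Rightarrow> ('a \<Rightarrow> 'a set) \<Rightarrow> 'a \<Rightarrow> bool" where
  "lsc_at X \<phi> x \<longleftrightarrow>
    (\<forall>U. openin (top_of_set X) U \<and> \<phi> x \<inter> U \<noteq> {} \<longrightarrow>
      (\<exists>\<delta>>0. \<forall>y\<in>X. dist x y \<le> \<delta> \<longrightarrow> \<phi> y \<inter> U \<noteq> {}))"

definition USC :: "'a::metric_space set \<Rightarrow> ('a \<Rightarrow> 'a set) \<Rightarrow> 'a set" where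
  "USC X \<phi> = {x \<in> X. usc_at X \<phi> x}"

definition LSC :: "'a::metric_space set \<Rightarrow> ('a \<Rightarrow> 'a set) \<Rightarrow> 'a set" where
  "LSC X \<phi> = {x \<in> X. lsc_at X \<phi> x}"

lemma subseq_tendsto_iff:
  fixes s :: "nat \<Rightarrow> 'a::metric_space"
  shows "(\<exists>i :: nat \<Rightarrow> nat. strict_mono i \<and> (\<lambda>j. s (i j)) \<longlonglongrightarrow> y) \<longleftrightarrow>
    (\<forall>e>0. \<forall>N. \<exists>n\<ge>N. dist (s n) y < e)" (is "?L \<longleftrightarrow> ?R")
proof
  assume ?L
  then obtain i :: "nat \<Rightarrow> nat" where i: "strict_mono i" "(\<lambda>j. s (i j)) \<longlonglongrightarrow> y" by blast
  show ?R
  proof (intro allI impI)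
    fix e :: real and N :: nat
    assume "e > 0"
    then obtain M where "\<forall>j\<ge>M. dist (s (i j)) y < e"
      using i(2) by (auto simp: lim_sequentially)
    then have "dist (s (i (max M N))) y < e" by simp
    moreover have "i (max M N) \<ge> N"
      using seq_suble[OF i(1), of "max M N"] by simp
    ultimately show "\<exists>n\<ge>N. dist (s n) y < e" by blast
  qed
next
  assume R: ?R
  define P where "P = (\<lambda>k n. dist (s n) y < inverse (real (Suc k)))"
  have "\<exists>i. \<forall>k. P k (i k) \<and> i k < i (Suc k)"
  proof (rule dependent_nat_choice)
    show "\<exists>n. P 0 n" using R[rule_format, of "inverse (real (Suc 0))" 0] by (auto simp: P_def)
    show "\<exists>m. P (Suc k) m \<and> n < m" for n k
      using R[rule_format, of "inverse (real (Suc (Suc k)))" "Suc n"]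
      by (auto simp: P_def Suc_le_eq simp del: of_nat_Suc)
  qed
  then obtain i where i: "\<And>k. P k (i k)" "\<And>k. i k < i (Suc k)" by blast
  have "(\<lambda>j. dist (s (i j)) y) \<longlonglongrightarrow> 0"
    by (rule tendsto_sandwich[OF _ _ tendsto_const LIMSEQ_inverse_real_of_nat])
      (use i(1) in \<open>auto simp: P_def less_imp_le simp del: of_nat_Suc\<close>)
  then have "(\<lambda>j. s (i j)) \<longlonglongrightarrow> y" by (rule iffD2[OF tendsto_dist_iff])
  moreover have "strict_mono i" using i(2) by (simp add: strict_mono_Suc_iff)
  ultimately show ?L by blast
qed

lemma omega_limit_in_closed_hyperspace:
  fixes X :: "'a::metric_space set"
  assumes "compact X" and f: "f \<in> X \<rightarrow> X"
  shows "omega_limit X f \<in> X \<rightarrow> closed_hyperspace X"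
proof
  fix x assume x: "x \<in> X"
  have orbit: "(f ^^ n) x \<in> X" for n by (induction n) (use x f in auto)
  have eq: "omega_limit X f x = {y \<in> X. \<forall>e>0. \<forall>N. \<exists>n\<ge>N. dist ((f ^^ n) x) y < e}"
    unfolding omega_limit_def subseq_tendsto_iff[where s = "\<lambda>n. (f ^^ n) x"] by simp
  have "seq_compact X" using \<open>compact X\<close> by (rule compact_imp_seq_compact)
  then obtain y r where "y \<in> X" "strict_mono r" "((\<lambda>n. (f ^^ n) x) \<circ> r) \<longlonglongrightarrow> y"
    by (rule seq_compactE[where f = "\<lambda>n. (f ^^ n) x"]) (use orbit in auto)
  then have "omega_limit X f x \<noteq> {}" by (auto simp: omega_limit_def o_def)
  moreover have "closed (omega_limit X f x)"
    unfolding closure_subset_eq[symmetric]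
  proof
    fix z assume "z \<in> closure (omega_limit X f x)"
    then have z: "\<forall>e>0. \<exists>y\<in>omega_limit X f x. dist y z < e" by (simp add: closure_approachable)
    have "z \<in> X"
      using z closed_approachable[OF compact_imp_closed[OF \<open>compact X\<close>]]
      unfolding omega_limit_def by blast
    moreover have "\<exists>n\<ge>N. dist ((f ^^ n) x) z < e" if "e > 0" for e N
    proof -
      from z \<open>e > 0\<close> obtain y where y: "y \<in> omega_limit X f x" "dist y z < e / 2"
        by (meson half_gt_zero)
      have "e / 2 > 0" using \<open>e > 0\<close> by simp
      with y(1) obtain n where "n \<ge> N" "dist ((f ^^ n) x) y < e / 2"
        unfolding eq by blast
      moreover have "dist ((f ^^ n) x) z \<le> dist ((f ^^ n) x) y + dist y z" by (rule dist_triangle)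
      ultimately show ?thesis using y(2) by (intro exI[of _ n]) linarith
    qed
    ultimately show "z \<in> omega_limit X f x" by (simp add: eq)
  qed
  ultimately show "omega_limit X f x \<in> closed_hyperspace X"
    by (auto simp: closed_hyperspace_def omega_limit_def intro!: closed_subset)
qed

end

theory Submission
  imports Defs
begin

text \<open>
  Upper semicontinuity makes every limit set minimal: if \<open>z \<in> \<omega>(x)\<close>, then iterates of \<open>x\<close>, whose
  limit set is \<open>\<omega>(x)\<close>, accumulate at \<open>z\<close>, so \<open>\<omega>(x) \<subseteq> \<omega>(z)\<close>. Hence, if an open set \<open>U\<close> meets
  \<open>\<omega>(x)\<close>, the orbit of every point of \<open>\<omega>(x)\<close> enters \<open>U\<close>, that is, \<open>\<omega>(x)\<close> is contained in the
  open set \<open>W\<close> of all points whose orbit enters \<open>U\<close>. By upper semicontinuity at \<open>x\<close> the set \<open>W\<close>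
  also contains \<open>\<omega>(y)\<close> for \<open>y\<close> near \<open>x\<close>, and since \<open>\<omega>(y)\<close> is non-empty and forward invariant,
  it meets \<open>U\<close>.
\<close>

lemma funpow_Pi: "f \<in> X \<rightarrow> X \<Longrightarrow> f ^^ n \<in> X \<rightarrow> X"
  by (induction n) auto

lemma continuous_on_funpow:
  assumes "continuous_on X f" and "f \<in> X \<rightarrow> X"
  shows "continuous_on X (f ^^ n)"
proof (induction n)
  case 0
  show ?case by (simp add: id_def)
next
  case (Suc n)
  have "(f ^^ n) ` X \<subseteq> X" using funpow_Pi[OF assms(2)] by auto
  then show ?case
    using continuous_on_compose[OF Suc continuous_on_subset[OF assms(1)]] by simp
qed

text \<open>Trades the subsequence for late returns to every ball, so that shifting times or picking
  one close iterate needs no index sequence.\<close>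

lemma omega_limit_iff:
  fixes X :: "'a::metric_space set"
  shows "y \<in> omega_limit X f x \<longleftrightarrow> y \<in> X \<and> (\<forall>e>0. \<forall>N. \<exists>n\<ge>N. dist ((f ^^ n) x) y < e)"
  using subseq_tendsto_iff[of "\<lambda>n. (f ^^ n) x" y] by (auto simp: omega_limit_def)

text \<open>Cluster points of a sequence survive the removal of its first \<open>n\<close>
  terms.\<close>

lemma omega_limit_subset_funpow:
  fixes X :: "'a::metric_space set"
  shows "omega_limit X f x \<subseteq> omega_limit X f ((f ^^ n) x)"
proof
  fix y assume y: "y \<in> omega_limit X f x"
  have "\<exists>m\<ge>N. dist ((f ^^ m) ((f ^^ n) x)) y < e" if "e > 0" for e N
  proof -
    \<comment> \<open>The margin \<open>n\<close> makes \<open>k - n\<close> at least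
      \<open>N\<close> and keeps the truncated subtraction exact.\<close>
    obtain k where "k \<ge> N + n" and k: "dist ((f ^^ k) x) y < e"
      using y \<open>e > 0\<close> unfolding omega_limit_iff by blast
    moreover have "(f ^^ (k - n)) ((f ^^ n) x) = (f ^^ k) x"
      using \<open>k \<ge> N + n\<close> funpow_add[of "k - n" n f] by simp
    ultimately show ?thesis by (intro exI[of _ "k - n"]) simp
  qed
  then show "y \<in> omega_limit X f ((f ^^ n) x)"
    using y by (simp add: omega_limit_iff)
qed

text \<open>Continuity of \<open>f ^^ k\<close> carries convergence along the times
  \<open>i j\<close> to convergence along \<open>k + i j\<close>.\<close>

lemma funpow_in_omega_limit:
  fixes X :: "'a::metric_space set"
  assumes "continuous_on X f" and f: "f \<in> X \<rightarrow> X" and "x \<in> X" and z: "z \<in> omega_limit X f x"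
  shows "(f ^^ k) z \<in> omega_limit X f x"
proof -
  obtain i where "z \<in> X" and i: "strict_mono i" "(\<lambda>j. (f ^^ i j) x) \<longlonglongrightarrow> z"
    using z by (auto simp: omega_limit_def)
  have orbit: "(f ^^ n) w \<in> X" if "w \<in> X" for n w
    using funpow_Pi[OF f] that by auto
  have "(\<lambda>j. (f ^^ k) ((f ^^ i j) x)) \<longlonglongrightarrow> (f ^^ k) z"
    by (rule continuous_on_tendsto_compose[OF continuous_on_funpow[OF assms(1,2)] i(2) \<open>z \<in> X\<close>])
      (use orbit \<open>x \<in> X\<close> in auto)
  then have "(\<lambda>j. (f ^^ (k + i j)) x) \<longlonglongrightarrow> (f ^^ k) z"
    by (simp add: funpow_add)
  moreover have "strict_mono (\<lambda>j. k + i j)"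
    using i(1) by (simp add: strict_mono_def)
  ultimately show ?thesis
    unfolding omega_limit_def using orbit[OF \<open>z \<in> X\<close>] by blast
qed

text \<open>A point \<open>p\<close> missing from the limit set of \<open>z\<close> would, by
  semicontinuity tested on the complement of \<open>p\<close>, be missing from that of every point
  near \<open>z\<close>. Some iterate of \<open>x\<close> is such a point, yet its limit set
  contains that of \<open>x\<close>.\<close>

lemma omega_limit_subset_of_usc_at:
  fixes X :: "'a::metric_space set"
  assumes f: "f \<in> X \<rightarrow> X" and "x \<in> X" and z: "z \<in> omega_limit X f x"
    and usc: "usc_at X (omega_limit X f) z"
  shows "omega_limit X f x \<subseteq> omega_limit X f z"
proof
  fix p assume p: "p \<in> omega_limit X f x"
  show "p \<in> omega_limit X f z"
  proof (rule ccontr)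
    assume "p \<notin> omega_limit X f z"
    then have "omega_limit X f z \<subseteq> X - {p}" by (auto simp: omega_limit_def)
    moreover have "openin (top_of_set X) (X - {p})"
      by (simp add: openin_delete)
    ultimately obtain \<delta> where "\<delta> > 0"
      and \<delta>: "\<And>y. y \<in> X \<Longrightarrow> dist z y \<le> \<delta> \<Longrightarrow> omega_limit X f y \<subseteq> X - {p}"
      using usc[unfolded usc_at_def, rule_format, of "X - {p}"] by auto
    obtain n where "dist ((f ^^ n) x) z < \<delta>"
      using z \<open>\<delta> > 0\<close> unfolding omega_limit_iff by blast
    then have "omega_limit X f ((f ^^ n) x) \<subseteq> X - {p}"
      using funpow_Pi[OF f] \<open>x \<in> X\<close> by (intro \<delta>) (auto simp: dist_commute)
    then show False using p omega_limit_subset_funpow by blast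
  qed
qed

lemma lsc_at_omega_limit:
  fixes X :: "'a::metric_space set"
  assumes "compact X" and cont: "continuous_on X f" and f: "f \<in> X \<rightarrow> X"
    and usc: "\<And>z. z \<in> X \<Longrightarrow> usc_at X (omega_limit X f) z" and "x \<in> X"
  shows "lsc_at X (omega_limit X f) x"
  unfolding lsc_at_def
proof (intro allI impI, elim conjE)
  fix U assume U: "openin (top_of_set X) U" "omega_limit X f x \<inter> U \<noteq> {}"
  then obtain p where p: "p \<in> omega_limit X f x" "p \<in> U" by blast
  define W where "W = (\<Union>k. X \<inter> (f ^^ k) -` U)"
  have "openin (top_of_set X) W"
    unfolding W_def
    using continuous_openin_preimage[OF continuous_on_funpow[OF cont f] funpow_Pi[OF f] U(1)]
    by blast
  moreover have "omega_limit X f x \<subseteq> W"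
  proof
    fix z assume z: "z \<in> omega_limit X f x"
    then have "z \<in> X" by (simp add: omega_limit_def)
    \<comment> \<open>Semicontinuity is used here at \<open>z\<close>; for the neighbourhood
      \<open>W\<close> it is used at \<open>x\<close>.\<close>
    then have "p \<in> omega_limit X f z"
      using omega_limit_subset_of_usc_at[OF f \<open>x \<in> X\<close> z usc] p(1) by blast
    moreover obtain e where "e > 0" and e: "\<And>w. w \<in> X \<Longrightarrow> dist w p < e \<Longrightarrow> w \<in> U"
      using U(1) p(2) unfolding openin_euclidean_subtopology_iff by blast
    ultimately obtain k where "dist ((f ^^ k) z) p < e"
      unfolding omega_limit_iff by blast
    then have "(f ^^ k) z \<in> U"
      using e funpow_Pi[OF f] \<open>z \<in> X\<close> by auto
    then show "z \<in> W" using \<open>z \<in> X\<close> by (auto simp: W_def)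
  qed
  ultimately obtain \<delta> where "\<delta> > 0"
    and \<delta>: "\<And>y. y \<in> X \<Longrightarrow> dist x y \<le> \<delta> \<Longrightarrow> omega_limit X f y \<subseteq> W"
    using usc[OF \<open>x \<in> X\<close>, unfolded usc_at_def, rule_format, of W] by auto
  have "omega_limit X f y \<inter> U \<noteq> {}" if y: "y \<in> X" "dist x y \<le> \<delta>" for y
  proof -
    \<comment> \<open>Compactness of \<open>X\<close> provides a point of the limit set.\<close>
    obtain z where z: "z \<in> omega_limit X f y"
      using omega_limit_in_closed_hyperspace[OF assms(1) f] y(1)
      by (auto simp: closed_hyperspace_def Pi_iff)
    then obtain k where "(f ^^ k) z \<in> U" using \<delta>[OF y] by (auto simp: W_def)
    \<comment> \<open>The iterate that lies in \<open>U\<close> has not left the limit set of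
      \<open>y\<close>.\<close>
    then show ?thesis using funpow_in_omega_limit[OF cont f y(1) z] by blast
  qed
  with \<open>\<delta> > 0\<close> show "\<exists>\<delta>>0. \<forall>y\<in>X. dist x y \<le> \<delta> \<longrightarrow> omega_limit X f y \<inter> U \<noteq> {}"
    by blast
qed

theorem theoremA1:
  fixes X :: "'a::metric_space set" and f :: "'a \<Rightarrow> 'a"
  assumes "compact X"
    and "continuous_on X f"
    and "f \<in> X \<rightarrow> X"
    and "X = USC X (omega_limit X f)"
  shows "X = LSC X (omega_limit X f)"
proof -
  have "usc_at X (omega_limit X f) z" if "z \<in> X" for z
  proof -
    have "z \<in> USC X (omega_limit X f)" using equalityD1[OF assms(4)] that by (rule subsetD)
    then show ?thesis by (simp add: USC_def)
  qed
  then show ?thesis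
    using lsc_at_omega_limit[OF assms(1-3)] by (auto simp: LSC_def)
qed

end
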